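(* Let $W$ be ULC($n$) with support $\{0,1,\ldots,n\}$ and mean $\lambda=nr>0$. Let $t>0$. Then $$\mathbb{P}(W\geq\lambda+t)\leq\left[\frac{(1-r)(\lambda+t)}{(1-r)\lambda-rt}\right]^{-(t+\lambda)}\left[1-r+\frac{r(1-r)(\lambda+t)}{(1-r)\lambda-rt}\right]^n,$$ $$\mathbb{P}(W\leq\lambda-t)\leq\left[\frac{(1-r)(\lambda-t)}{(1-r)\lambda+rt}\right]^{t-\lambda}\left[1-r+\frac{r(1-r)(\lambda-t)}{(1-r)\lambda+rt}\right]^n,$$ where the last inequality applies if $t<\lambda$.
   Context: $n>0$ is an integer and $W$ is a non-negative, integer-valued random variable. A random variable $X$ supported on $\{0,1,\ldots,n\}$ is ULC($n$) (ultra log-concave of degree $n$) if $\frac{\mathbb{P}(X=i+1)^2}{\binom{n}{i+1}^2}\geq\frac{\mathbb{P}(X=i)}{\binom{n}{i}}\frac{\mathbb{P}(X=i+2)}{\binom{n}{i+2}}$ for $0\leq i\leq n-2$.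
   Formalization: The first inequality is proved for (1-r)λ-rt>0, i.e. λ+t<n; at λ+t=n its right side divides by zero, and for λ+t>n the base is negative and the bound can fail (n=1, r=1/2, t=3/2 gives 0≤-1/8). *)

theory Defs
  imports "HOL-Probability.Probability"
begin

text \<open>The support of a discrete random variable is its set of atoms.\<close>

definition rv_support :: "'a measure \<Rightarrow> ('a \<Rightarrow> nat) \<Rightarrow> nat set" where
  "rv_support M X = {k. \<P>(\<omega> in M. X \<omega> = k) > 0}"

text \<open>Being supported on \<open>{0..n}\<close> only says that no mass lies outside \<open>{0..n}\<close>; the support may be
  a proper subset of it.\<close>

definition ULC :: "nat \<Rightarrow> 'a measure \<Rightarrow> ('a \<Rightarrow> nat) \<Rightarrow> bool" where
  "ULC n M X \<longleftrightarrow>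
     X \<in> measurable M (count_space UNIV) \<and>
     (AE \<omega> in M. X \<omega> \<in> {0..n}) \<and>
     (\<forall>i. i + 2 \<le> n \<longrightarrow>
        (\<P>(\<omega> in M. X \<omega> = i + 1))\<^sup>2 / (real (n choose (i + 1)))\<^sup>2 \<ge>
        \<P>(\<omega> in M. X \<omega> = i) / real (n choose i) *
        (\<P>(\<omega> in M. X \<omega> = i + 2) / real (n choose (i + 2))))"

end

theory Submission
  imports Defs
begin

text \<open>
  Since \<open>W\<close> has full support, \<open>0 < r < 1\<close>, and the binomial law with parameters \<open>n\<close> and \<open>r\<close> has
  the same total mass and the same mean as \<open>W\<close>.  Ultra log-concavity says exactly that the ratio of
  the two mass functions is log-concave: the geometric factors of the binomial weights cancel from
  the log-concavity inequality.  A log-concave ratio exceeds \<open>1\<close> on an interval only, so the law of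
  \<open>W\<close> is larger than the binomial one in the middle and smaller in both tails.  With equal means, \<open>W\<close>
  is therefore dominated by the binomial law in the convex order
  (\<open>sum_convex_le_of_log_concave_ratio\<close>).

  Applied to the convex function \<open>x \<mapsto> z powr x\<close>, this bounds the generating function of \<open>W\<close> at \<open>z\<close> by
  \<open>(1 - r + r * z) ^ n\<close>, and Markov's inequality turns this into a tail bound for each \<open>z > 0\<close>
  (\<open>ULC_chernoff\<close>).  The two bounds of the theorem are this one at the optimal \<open>z\<close>, namely the value
  at which the binomial law tilted by \<open>z\<close> has mean \<open>lam + t\<close>, respectively \<open>lam - t\<close>; then \<open>z > 1\<close> for
  the upper tail and \<open>z < 1\<close> for the lower one.
\<close>

section \<open>Convex comparison of mass functions with log-concave ratio\<close>

text \<open>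
  If the sequence dipped below both ends, its last minimum would be an interior point whose left
  neighbour is at least as large and whose right neighbour is strictly larger.
\<close>

lemma log_concave_ge_min_ends:
  fixes f :: "nat \<Rightarrow> real"
  assumes pos: "\<And>i. i \<le> n \<Longrightarrow> f i > 0"
    and lc: "\<And>i. i + 2 \<le> n \<Longrightarrow> f i * f (i + 2) \<le> (f (i + 1))\<^sup>2"
    and "i \<le> j" "j \<le> k" "k \<le> n" "f i \<ge> c" "f k \<ge> c"
  shows "f j \<ge> c"
proof (rule ccontr)
  assume "\<not> f j \<ge> c"
  define \<mu> where "\<mu> = Min (f ` {i..k})"
  define S where "S = {m \<in> {i..k}. f m = \<mu>}"
  define m where "m = Max S"
  have \<mu>_le: "\<mu> \<le> f x" if "x \<in> {i..k}" for x
    using that by (auto simp: \<mu>_def)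
  have "\<mu> \<in> f ` {i..k}"
    unfolding \<mu>_def using assms by (intro Min_in) auto
  then have "S \<noteq> {}" "finite S"
    by (auto simp: S_def)
  then have "m \<in> S" and last: "\<And>x. x \<in> S \<Longrightarrow> x \<le> m"
    by (auto simp: m_def)
  then have m: "i \<le> m" "m \<le> k" "f m = \<mu>"
    by (auto simp: S_def)
  have "\<mu> < c"
    using \<mu>_le[of j] assms \<open>\<not> f j \<ge> c\<close> by auto
  then have "m \<noteq> i" "m \<noteq> k"
    using m assms by auto
  with m obtain l where l: "m = l + 1" "i \<le> l" "l + 2 \<le> k"
    by (intro that[of "m - 1"]) auto
  have left: "f l \<ge> \<mu>"
    using l by (intro \<mu>_le) auto
  have "l + 2 \<notin> S"
    using last[of "l + 2"] l by auto
  then have right: "f (l + 2) > \<mu>"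
    using \<mu>_le[of "l + 2"] l by (auto simp: S_def)
  have "\<mu> > 0"
    using pos[of m] m assms by auto
  then have "\<mu>\<^sup>2 < f l * f (l + 2)"
    using left right by (simp add: power2_eq_square mult_le_less_imp_less)
  moreover have "f l * f (l + 2) \<le> \<mu>\<^sup>2"
    using lc[of l] l m assms by auto
  ultimately show False
    by simp
qed

text \<open>
  The chord inequality without division; reading it with the roles of the three points exchanged
  gives the sign of a convex function minus one of its chords on either side of the chord.
\<close>

lemma convex_on_three_points:
  fixes g :: "real \<Rightarrow> real"
  assumes "convex_on UNIV g" "x \<le> y" "y \<le> z"
  shows "(z - x) * g y \<le> (z - y) * g x + (y - x) * g z"
proof (cases "x = z")
  case False
  then have "x < z"
    using assms by simp
  have "convex_on {x..z} g"
    using assms(1) by (rule convex_on_subset) auto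
  then have "g y \<le> (g z - g x) / (z - x) * (y - x) + g x"
    using assms by (intro convex_onD_Icc') auto
  then have "(z - x) * g y \<le> (z - x) * ((g z - g x) / (z - x) * (y - x) + g x)"
    using \<open>x < z\<close> by (intro mult_left_mono) auto
  also have "\<dots> = (z - y) * g x + (y - x) * g z"
    using \<open>x < z\<close> by (simp add: field_simps)
  finally show ?thesis .
qed (use assms in auto)

text \<open>
  The set where \<open>p \<ge> q\<close> is an interval.  The chord of \<open>g\<close> over that interval lies above \<open>g\<close> inside
  it and below \<open>g\<close> outside, so \<open>g\<close> minus the chord and \<open>p - q\<close> have opposite signs everywhere, while
  the two moment conditions make the chord, an affine function, contribute nothing to the difference
  of the two sums.
\<close>

lemma sum_convex_le_of_log_concave_ratio:
  fixes p q :: "nat \<Rightarrow> real" and g :: "real \<Rightarrow> real"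
  assumes g: "convex_on UNIV g"
    and p: "\<And>i. i \<le> n \<Longrightarrow> p i > 0" and q: "\<And>i. i \<le> n \<Longrightarrow> q i > 0"
    and lc: "\<And>i. i + 2 \<le> n \<Longrightarrow>
      p i / q i * (p (i + 2) / q (i + 2)) \<le> (p (i + 1) / q (i + 1))\<^sup>2"
    and mass: "(\<Sum>i\<le>n. p i) = (\<Sum>i\<le>n. q i)"
    and mean: "(\<Sum>i\<le>n. real i * p i) = (\<Sum>i\<le>n. real i * q i)"
  shows "(\<Sum>i\<le>n. g (real i) * p i) \<le> (\<Sum>i\<le>n. g (real i) * q i)"
proof -
  define S where "S = {i \<in> {..n}. q i \<le> p i}"
  have "S \<noteq> {}"
  proof
    assume "S = {}"
    then have "p i < q i" if "i \<le> n" for i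
      using that by (force simp: S_def)
    then have "(\<Sum>i\<le>n. p i) < (\<Sum>i\<le>n. q i)"
      by (intro sum_strict_mono) auto
    with mass show False
      by simp
  qed
  have "finite S"
    by (simp add: S_def)
  have S_iff: "i \<in> S \<longleftrightarrow> i \<le> n \<and> p i / q i \<ge> 1" for i
    using q[of i] by (auto simp: S_def field_simps)
  define a where "a = Min S"
  \<comment> \<open>If \<open>S\<close> is a single point, the chord to the next integer serves as a supporting line: both its
    end points give \<open>H = 0\<close>, and no integer lies strictly between them.\<close>
  define b where "b = max (Max S) (a + 1)"
  have a: "a \<in> S" "\<And>i. i \<in> S \<Longrightarrow> a \<le> i"
    using \<open>S \<noteq> {}\<close> \<open>finite S\<close> by (auto simp: a_def)
  have b: "a < b" "\<And>i. i \<in> S \<Longrightarrow> i \<le> b"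
    using \<open>S \<noteq> {}\<close> \<open>finite S\<close> by (auto simp: b_def intro: le_max_iff_disj[THEN iffD2])
  have inside: "i \<in> S" if "a < i" "i < b" for i
  proof -
    have "b = Max S"
      using that by (auto simp: b_def)
    then have "b \<in> S"
      using \<open>S \<noteq> {}\<close> \<open>finite S\<close> by simp
    then have "b \<le> n"
      by (simp add: S_iff)
    have "p i / q i \<ge> 1"
      using log_concave_ge_min_ends[of n "\<lambda>i. p i / q i" a i b 1] p q lc \<open>b \<in> S\<close> a that
      by (auto simp: S_iff)
    with that \<open>b \<le> n\<close> show ?thesis
      by (simp add: S_iff)
  qed
  define H where "H i = (real b - real a) * g (real i)
      - ((real b - real i) * g (real a) + (real i - real a) * g (real b))" for i
  have H_le: "H i \<le> 0" if "a \<le> i" "i \<le> b" for i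
    using convex_on_three_points[OF g, of a i b] that by (simp add: H_def algebra_simps)
  have H_ge: "H i \<ge> 0" if "i \<le> a \<or> b \<le> i" for i
    using convex_on_three_points[OF g, of i a b] convex_on_three_points[OF g, of a b i] that b(1)
    by (auto simp: H_def algebra_simps)
  have "H i * (p i - q i) \<le> 0" if "i \<le> n" for i
  proof (cases "i \<in> S")
    case True
    then show ?thesis
      using H_le[of i] a(2) b(2) by (auto simp: S_def mult_le_0_iff)
  next
    case False
    then have "i \<le> a \<or> b \<le> i"
      using inside[of i] by force
    with False that show ?thesis
      using H_ge[of i] by (auto simp: S_def mult_le_0_iff)
  qed
  then have "(\<Sum>i\<le>n. H i * (p i - q i)) \<le> 0"
    by (intro sum_nonpos) auto
  also have "(\<Sum>i\<le>n. H i * (p i - q i))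
      = (\<Sum>i\<le>n. (real b - real a) * (g (real i) * p i - g (real i) * q i)
          - (real b * g (real a) - real a * g (real b)) * (p i - q i)
          - (g (real b) - g (real a)) * (real i * p i - real i * q i))"
    by (intro sum.cong) (auto simp: H_def algebra_simps)
  also have "\<dots> = (real b - real a) * ((\<Sum>i\<le>n. g (real i) * p i) - (\<Sum>i\<le>n. g (real i) * q i))"
    by (simp add: sum_subtractf mass mean flip: sum_distrib_left)
  finally show ?thesis
    using b(1) by (simp add: mult_le_0_iff)
qed

section \<open>Ultra log-concave laws against the binomial law\<close>

lemma (in prob_space) expectation_nat_bounded:
  fixes W :: "'a \<Rightarrow> nat" and g :: "nat \<Rightarrow> real"
  assumes [measurable]: "W \<in> measurable M (count_space UNIV)"
    and bdd: "AE \<omega> in M. W \<omega> \<in> {0..n}"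
  shows "expectation (\<lambda>\<omega>. g (W \<omega>)) = (\<Sum>i\<le>n. g i * \<P>(\<omega> in M. W \<omega> = i))"
proof -
  have "expectation (\<lambda>\<omega>. g (W \<omega>))
      = expectation (\<lambda>\<omega>. \<Sum>i\<le>n. g i * indicator {\<omega> \<in> space M. W \<omega> = i} \<omega>)"
  proof (rule integral_cong_AE)
    show "AE \<omega> in M. g (W \<omega>) = (\<Sum>i\<le>n. g i * indicator {\<omega> \<in> space M. W \<omega> = i} \<omega>)"
      using bdd AE_space
    proof eventually_elim
      case (elim \<omega>)
      then have "(\<Sum>i\<le>n. g i * indicator {\<omega> \<in> space M. W \<omega> = i} \<omega>)
          = (\<Sum>i\<le>n. if W \<omega> = i then g i else 0)"
        by (intro sum.cong) (auto simp: indicator_def)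
      with elim show ?case
        by simp
    qed
  qed measurable
  also have "\<dots> = (\<Sum>i\<le>n. g i * \<P>(\<omega> in M. W \<omega> = i))"
    by (subst Bochner_Integration.integral_sum)
      (auto intro!: integrable_real_indicator simp: less_top[symmetric])
  finally show ?thesis .
qed

lemma convex_on_powr_exponent:
  fixes z :: real
  assumes "z > 0"
  shows "convex_on UNIV (\<lambda>x. z powr x)"
proof (rule convex_on_realI)
  show "((\<lambda>x. z powr x) has_real_derivative z powr x * ln z) (at x)" for x
    using assms by (auto intro!: derivative_eq_intros)
  show "z powr x * ln z \<le> z powr y * ln z" if "x \<le> y" for x y
  proof (cases "z \<ge> 1")
    case True
    then show ?thesis
      using that by (intro mult_right_mono powr_mono) auto
  next
    case False
    then show ?thesis
      using that assms by (intro mult_right_mono_neg powr_mono') auto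
  qed
qed auto

text \<open>
  The weights of the binomial law with parameters \<open>n\<close> and \<open>r\<close> are the Bernstein polynomials
  evaluated at \<open>r\<close>.
\<close>

lemma sum_power_Bernstein:
  "(\<Sum>i\<le>n. z ^ i * Bernstein n i r) = (1 - r + r * z) ^ n"
proof -
  have "(1 - r + r * z) ^ n = (r * z + (1 - r)) ^ n"
    by (simp add: add.commute)
  also have "\<dots> = (\<Sum>i\<le>n. z ^ i * Bernstein n i r)"
    unfolding binomial_ring
    by (intro sum.cong) (auto simp: Bernstein_def power_mult_distrib mult_ac)
  finally show ?thesis ..
qed

lemma ULC_Bernstein_ratio_log_concave:
  assumes "ULC n M W" "0 < r" "r < 1" "i + 2 \<le> n"
  defines "p \<equiv> \<lambda>i. \<P>(\<omega> in M. W \<omega> = i)"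
  shows "p i / Bernstein n i r * (p (i + 2) / Bernstein n (i + 2) r)
    \<le> (p (i + 1) / Bernstein n (i + 1) r)\<^sup>2"
proof -
  \<comment> \<open>The geometric factor of the middle binomial weight; its square is the product of those of the
    two outer weights.\<close>
  define c where "c = r ^ (i + 1) * (1 - r) ^ (n - (i + 1))"
  have n1: "n - (i + 1) = Suc (n - (i + 2))" and n0: "n - i = Suc (Suc (n - (i + 2)))"
    using assms by auto
  have c: "r ^ i * (1 - r) ^ (n - i) * (r ^ (i + 2) * (1 - r) ^ (n - (i + 2))) = c\<^sup>2"
    unfolding c_def n1 n0 by (simp add: power2_eq_square algebra_simps)
  have "p i / Bernstein n i r * (p (i + 2) / Bernstein n (i + 2) r)
      = p i / real (n choose i) * (p (i + 2) / real (n choose (i + 2))) / c\<^sup>2"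
    unfolding Bernstein_def c[symmetric] by (simp add: mult_ac)
  also have "\<dots> \<le> ((p (i + 1))\<^sup>2 / (real (n choose (i + 1)))\<^sup>2) / c\<^sup>2"
    using assms(1,4) by (intro divide_right_mono) (auto simp: ULC_def p_def)
  also have "\<dots> = (p (i + 1) / Bernstein n (i + 1) r)\<^sup>2"
    by (simp add: Bernstein_def c_def power_divide power_mult_distrib mult_ac)
  finally show ?thesis .
qed

text \<open>
  The mean stays below \<open>n\<close> because \<open>0\<close> is an atom; this is what makes \<open>r < 1\<close> and all binomial
  weights positive.
\<close>

lemma (in prob_space) full_support_mean_less:
  fixes W :: "'a \<Rightarrow> nat"
  assumes "n > 0" "W \<in> measurable M (count_space UNIV)" "AE \<omega> in M. W \<omega> \<in> {0..n}"
    and "rv_support M W = {0..n}"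
  shows "expectation (\<lambda>\<omega>. real (W \<omega>)) < real n"
proof -
  define p where "p i = \<P>(\<omega> in M. W \<omega> = i)" for i
  note E = expectation_nat_bounded[OF assms(2,3), folded p_def]
  have p: "p i > 0" if "i \<le> n" for i
    using assms(4) that by (auto simp: rv_support_def p_def set_eq_iff)
  have "(\<Sum>i\<le>n. real i * p i) < (\<Sum>i\<le>n. real n * p i)"
    by (rule sum_strict_mono_ex1)
      (use p assms(1) in \<open>auto simp: intro!: mult_right_mono bexI[of _ 0] less_imp_le\<close>)
  then show ?thesis
    using E[of real] E[of "\<lambda>_. real n"] by (simp add: prob_space)
qed

section \<open>Tail bounds\<close>

text \<open>
  The hypothesis on \<open>P\<close> is the pointwise form of Markov's inequality for \<open>z powr W\<close>; stating it this
  way serves both tails at once.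
\<close>

lemma (in prob_space) ULC_chernoff:
  fixes W :: "'a \<Rightarrow> nat"
  assumes ulc: "ULC n M W" and supp: "rv_support M W = {0..n}"
    and mean: "expectation (\<lambda>\<omega>. real (W \<omega>)) = real n * r"
    and r: "0 < r" "r < 1" and z: "z > 0"
    and P: "\<And>i. P i \<Longrightarrow> 1 \<le> z powr (real i - a)"
  shows "\<P>(\<omega> in M. P (W \<omega>)) \<le> z powr (- a) * (1 - r + r * z) ^ n"
proof -
  define p where "p i = \<P>(\<omega> in M. W \<omega> = i)" for i
  have W [measurable]: "W \<in> measurable M (count_space UNIV)"
    and bdd: "AE \<omega> in M. W \<omega> \<in> {0..n}"
    using ulc by (auto simp: ULC_def)
  note E = expectation_nat_bounded[OF W bdd, folded p_def]
  have p: "p i > 0" if "i \<le> n" for i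
    using supp that by (auto simp: rv_support_def p_def set_eq_iff)
  have gf: "(\<Sum>i\<le>n. z powr (real i) * p i) \<le> (\<Sum>i\<le>n. z powr (real i) * Bernstein n i r)"
  proof (rule sum_convex_le_of_log_concave_ratio)
    show "convex_on UNIV (\<lambda>x. z powr x)"
      using z by (rule convex_on_powr_exponent)
    show "Bernstein n i r > 0" if "i \<le> n" for i
      using r that by (simp add: Bernstein_pos)
    show "p i / Bernstein n i r * (p (i + 2) / Bernstein n (i + 2) r)
        \<le> (p (i + 1) / Bernstein n (i + 1) r)\<^sup>2" if "i + 2 \<le> n" for i
      using ULC_Bernstein_ratio_log_concave[OF ulc r that] by (simp add: p_def)
    show "(\<Sum>i\<le>n. p i) = (\<Sum>i\<le>n. Bernstein n i r)"
      using E[of "\<lambda>_. 1"] by (simp add: prob_space)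
    show "(\<Sum>i\<le>n. real i * p i) = (\<Sum>i\<le>n. real i * Bernstein n i r)"
      using E[of real] mean by simp
  qed (use p in auto)
  have "\<P>(\<omega> in M. P (W \<omega>)) = expectation (\<lambda>\<omega>. indicator {\<omega> \<in> space M. P (W \<omega>)} \<omega>)"
    by simp
  also have "\<dots> = expectation (\<lambda>\<omega>. indicator {i. P i} (W \<omega>))"
    by (intro Bochner_Integration.integral_cong) (auto simp: indicator_def)
  also have "\<dots> = (\<Sum>i\<le>n. indicator {i. P i} i * p i)"
    by (rule E)
  also have "\<dots> \<le> (\<Sum>i\<le>n. z powr (real i - a) * p i)"
    using p P z by (intro sum_mono mult_right_mono) (auto simp: indicator_def less_imp_le)
  also have "\<dots> = z powr (- a) * (\<Sum>i\<le>n. z powr (real i) * p i)"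
    using z by (simp add: sum_distrib_left powr_diff powr_minus field_simps)
  also have "\<dots> \<le> z powr (- a) * (\<Sum>i\<le>n. z powr (real i) * Bernstein n i r)"
    using gf by (intro mult_left_mono) auto
  also have "(\<Sum>i\<le>n. z powr (real i) * Bernstein n i r) = (1 - r + r * z) ^ n"
    using z by (simp add: powr_realpow sum_power_Bernstein)
  finally show ?thesis .
qed

theorem corollary4p5:
  fixes M :: "'a measure" and W :: "'a \<Rightarrow> nat" and n :: nat and lam r t :: real
  assumes "prob_space M"
    and "n > 0"
    and "ULC n M W"
    and "rv_support M W = {0..n}"
    and "lam = (\<integral>\<omega>. real (W \<omega>) \<partial>M)"
    and "lam = real n * r"
    and "lam > 0"
    and "t > 0"
  shows "((1 - r) * lam - r * t > 0 \<longrightarrow>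
           \<P>(\<omega> in M. real (W \<omega>) \<ge> lam + t)
             \<le> (((1 - r) * (lam + t)) / ((1 - r) * lam - r * t)) powr (- (t + lam))
               * (1 - r + (r * (1 - r) * (lam + t)) / ((1 - r) * lam - r * t)) ^ n)
       \<and> (t < lam \<longrightarrow>
           \<P>(\<omega> in M. real (W \<omega>) \<le> lam - t)
             \<le> (((1 - r) * (lam - t)) / ((1 - r) * lam + r * t)) powr (t - lam)
               * (1 - r + (r * (1 - r) * (lam - t)) / ((1 - r) * lam + r * t)) ^ n)"
proof -
  interpret prob_space M
    by fact
  have "lam < real n"
    using full_support_mean_less[of n W] assms by (simp add: ULC_def)
  then have r: "0 < r" "r < 1"
    using assms(2,6,7) by (auto simp: zero_less_mult_iff)
  have mean: "expectation (\<lambda>\<omega>. real (W \<omega>)) = real n * r"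
    using assms(5,6) by simp
  note chernoff = ULC_chernoff[OF assms(3,4) mean r]
  have upper: "\<P>(\<omega> in M. real (W \<omega>) \<ge> lam + t)
      \<le> (((1 - r) * (lam + t)) / ((1 - r) * lam - r * t)) powr (- (t + lam))
        * (1 - r + (r * (1 - r) * (lam + t)) / ((1 - r) * lam - r * t)) ^ n"
    if D: "(1 - r) * lam - r * t > 0"
  proof -
    define z where "z = ((1 - r) * (lam + t)) / ((1 - r) * lam - r * t)"
    have "z \<ge> 1"
      using D assms(8) by (simp add: z_def field_simps)
    have "\<P>(\<omega> in M. real (W \<omega>) \<ge> lam + t) \<le> z powr (- (lam + t)) * (1 - r + r * z) ^ n"
      by (rule chernoff) (use \<open>z \<ge> 1\<close> in \<open>auto intro!: ge_one_powr_ge_zero\<close>)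
    then show ?thesis
      by (simp add: z_def add.commute mult.assoc)
  qed
  have lower: "\<P>(\<omega> in M. real (W \<omega>) \<le> lam - t)
      \<le> (((1 - r) * (lam - t)) / ((1 - r) * lam + r * t)) powr (t - lam)
        * (1 - r + (r * (1 - r) * (lam - t)) / ((1 - r) * lam + r * t)) ^ n"
    if "t < lam"
  proof -
    define z where "z = ((1 - r) * (lam - t)) / ((1 - r) * lam + r * t)"
    have D: "(1 - r) * lam + r * t > 0"
      using r assms(7,8) by (intro add_pos_pos mult_pos_pos) auto
    have "z > 0"
      using D r that by (simp add: z_def)
    have "z \<le> 1"
      using D assms(8) by (simp add: z_def field_simps)
    have "\<P>(\<omega> in M. real (W \<omega>) \<le> lam - t) \<le> z powr (- (lam - t)) * (1 - r + r * z) ^ n"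
    proof (rule chernoff)
      show "1 \<le> z powr (real i - (lam - t))" if "real i \<le> lam - t" for i
        using powr_mono'[of "real i - (lam - t)" 0 z] that \<open>z > 0\<close> \<open>z \<le> 1\<close> by simp
    qed (use \<open>z > 0\<close> in auto)
    then show ?thesis
      by (simp add: z_def mult.assoc)
  qed
  from upper lower show ?thesis
    by blast
qed

end
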